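(* Let $\ell, m\ge 2$ and $a,b$ be integers with $1<a<\ell \leq b$, and let $H = H(\ell,m,a,b)$ be the mixed hypergraph defined below. Then $S(H) = [a,\ell-1] \cup \{b\}$. Moreover, every proper $a$-coloring of $H$ is a row-coloring and every proper $b$-coloring of $H$ is a column-coloring.
   Context: A mixed hypergraph is a triple $H=(V,\mathcal{C},\mathcal{D})$ with $V$ a finite vertex set and $\mathcal{C}$, $\mathcal{D}$ sets of subsets of $V$ ($C$-edges and $D$-edges). A coloring $c:V\to\mathbb{N}$ is proper if every $C$-edge contains two vertices of the same color and every $D$-edge contains two vertices of distinct colors; an $s$-coloring uses exactly $s$ colors; $S(H)$ is the set of all $s$ such that $H$ has a proper $s$-coloring. $[i,j]=\{i,\ldots,j\}$. Definition of $H(\ell,m,a,b)$: its vertex set is $V = [a]\times [b] \times [m]$. For $x\in[a]$, the set $\{x\}\times [b]\times[m]$ is a row; for $y\in[b]$, the set $[a]\times\{y\}\times[m]$ is a column. The $C$-edges are all $\ell$-element subsets of $V$ containing at least two vertices from the same column. The $D$-edges are all $m$-element subsets of $V$ that are not contained in any single row and not contained in any single column. A row-coloring is a coloring in which every row is monochromatic and vertices in distinct rows get distinct colors; a column-coloring is a coloring in which every column is monochromatic and vertices in distinct columns get distinct colors. *)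

theory Defs
  imports Main
begin

record 'v mixed_hypergraph =
  verts :: "'v set"
  C_edges :: "'v set set"
  D_edges :: "'v set set"

definition is_mixed_hypergraph :: "'v mixed_hypergraph \<Rightarrow> bool" where
  "is_mixed_hypergraph H \<longleftrightarrow>
     finite (verts H) \<and> C_edges H \<subseteq> Pow (verts H) \<and> D_edges H \<subseteq> Pow (verts H)"

text \<open>
  A coloring is a total function on the vertex type; its values outside the vertex set
  never matter, since all notions below evaluate it on vertices only.
\<close>

definition proper_coloring :: "'v mixed_hypergraph \<Rightarrow> ('v \<Rightarrow> nat) \<Rightarrow> bool" where
  "proper_coloring H c \<longleftrightarrow>
     (\<forall>e\<in>C_edges H. \<exists>u\<in>e. \<exists>v\<in>e. u \<noteq> v \<and> c u = c v) \<and>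
     (\<forall>e\<in>D_edges H. \<exists>u\<in>e. \<exists>v\<in>e. c u \<noteq> c v)"

definition proper_s_coloring :: "'v mixed_hypergraph \<Rightarrow> nat \<Rightarrow> ('v \<Rightarrow> nat) \<Rightarrow> bool" where
  "proper_s_coloring H s c \<longleftrightarrow> proper_coloring H c \<and> card (c ` verts H) = s"

definition S :: "'v mixed_hypergraph \<Rightarrow> nat set" where
  "S H = {s. \<exists>c. proper_s_coloring H s c}"

type_synonym vertex = "nat \<times> nat \<times> nat"

definition grid :: "nat \<Rightarrow> nat \<Rightarrow> nat \<Rightarrow> vertex set" where
  "grid m a b = {1..a} \<times> {1..b} \<times> {1..m}"

definition row :: "nat \<Rightarrow> nat \<Rightarrow> nat \<Rightarrow> vertex set" where
  "row m b x = {x} \<times> {1..b} \<times> {1..m}"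

definition column :: "nat \<Rightarrow> nat \<Rightarrow> nat \<Rightarrow> vertex set" where
  "column m a y = {1..a} \<times> {y} \<times> {1..m}"

definition grid_hypergraph :: "nat \<Rightarrow> nat \<Rightarrow> nat \<Rightarrow> nat \<Rightarrow> vertex mixed_hypergraph" where
  "grid_hypergraph l m a b =
     \<lparr> verts = grid m a b,
       C_edges = {e. e \<subseteq> grid m a b \<and> card e = l \<and>
                    (\<exists>y\<in>{1..b}. \<exists>u\<in>e. \<exists>v\<in>e. u \<noteq> v \<and> u \<in> column m a y \<and> v \<in> column m a y)},
       D_edges = {e. e \<subseteq> grid m a b \<and> card e = m \<and>
                    \<not> (\<exists>x\<in>{1..a}. e \<subseteq> row m b x) \<and>
                    \<not> (\<exists>y\<in>{1..b}. e \<subseteq> column m a y)} \<rparr>"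

lemma is_mixed_hypergraph_grid_hypergraph: "is_mixed_hypergraph (grid_hypergraph l m a b)"
  by (auto simp: is_mixed_hypergraph_def grid_hypergraph_def grid_def)

definition monochromatic :: "('v \<Rightarrow> nat) \<Rightarrow> 'v set \<Rightarrow> bool" where
  "monochromatic c A \<longleftrightarrow> (\<forall>u\<in>A. \<forall>v\<in>A. c u = c v)"

definition row_coloring :: "nat \<Rightarrow> nat \<Rightarrow> nat \<Rightarrow> (vertex \<Rightarrow> nat) \<Rightarrow> bool" where
  "row_coloring m a b c \<longleftrightarrow>
     (\<forall>x\<in>{1..a}. monochromatic c (row m b x)) \<and>
     (\<forall>x\<in>{1..a}. \<forall>x'\<in>{1..a}. x \<noteq> x' \<longrightarrow>
        (\<forall>u\<in>row m b x. \<forall>v\<in>row m b x'. c u \<noteq> c v))"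

definition column_coloring :: "nat \<Rightarrow> nat \<Rightarrow> nat \<Rightarrow> (vertex \<Rightarrow> nat) \<Rightarrow> bool" where
  "column_coloring m a b c \<longleftrightarrow>
     (\<forall>y\<in>{1..b}. monochromatic c (column m a y)) \<and>
     (\<forall>y\<in>{1..b}. \<forall>y'\<in>{1..b}. y \<noteq> y' \<longrightarrow>
        (\<forall>u\<in>column m a y. \<forall>v\<in>column m a y'. c u \<noteq> c v))"

end

theory Submission
  imports Defs
begin

text \<open>
  Two vertices in different rows and in different columns extend to a \<open>D\<close>-edge inside any large
  enough set containing both, so each color class has fewer than \<open>m\<close> vertices or lies in a row or
  in a column; in particular it has at most \<open>b * m\<close> vertices, with equality only for full rows.
  Counting the \<open>a * b * m\<close> vertices gives at least \<open>a\<close> colors, and exactly \<open>a\<close> only for a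
  row-coloring. With at least \<open>l\<close> colors, two differently colored vertices of one column would
  extend to a \<open>C\<close>-edge with pairwise distinct colors; hence the columns are monochromatic, and
  they have different colors because the union of two columns is too large for a color class.
\<close>

section \<open>Color classes and their position relative to rows and columns\<close>

abbreviation color_class :: "nat \<Rightarrow> nat \<Rightarrow> nat \<Rightarrow> (vertex \<Rightarrow> nat) \<Rightarrow> nat \<Rightarrow> vertex set" where
  "color_class m a b c k \<equiv> {v \<in> grid m a b. c v = k}"

lemma finite_grid: "finite (grid m a b)"
  by (simp add: grid_def)

lemma card_grid: "card (grid m a b) = a * (b * m)"
  by (simp add: grid_def card_cartesian_product)

lemma card_row: "card (row m b x) = b * m"
  by (simp add: row_def card_cartesian_product)

lemma card_column: "card (column m a y) = a * m"
  by (simp add: column_def card_cartesian_product)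

text \<open>Take a point \<open>p\<close> of \<open>K\<close>, a point \<open>q\<close> outside its
  row and a point \<open>r\<close> outside its column. Either \<open>p\<close> pairs with one of
  them, or \<open>q\<close> shares the column of \<open>p\<close> and \<open>r\<close> its row, and
  then \<open>q\<close> and \<open>r\<close> differ in both coordinates.\<close>

lemma not_in_line_imp_differ_in_both:
  assumes "1 \<le> a" "K \<subseteq> grid m a b"
    and "\<not> (\<exists>x\<in>{1..a}. K \<subseteq> row m b x)" "\<not> (\<exists>y\<in>{1..b}. K \<subseteq> column m a y)"
  obtains u v where "u \<in> K" "v \<in> K" "fst u \<noteq> fst v" "fst (snd u) \<noteq> fst (snd v)"
proof -
  have "K \<noteq> {}" using assms(1,3) by force
  then obtain x y z where p: "(x, y, z) \<in> K" by force
  then have xy: "x \<in> {1..a}" "y \<in> {1..b}" using assms(2) by (auto simp: grid_def)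
  obtain q where q: "q \<in> K" "q \<notin> row m b x" using assms(3) xy by blast
  obtain r where r: "r \<in> K" "r \<notin> column m a y" using assms(4) xy by blast
  have q': "fst q \<noteq> x" using q assms(2) by (auto simp: grid_def row_def)
  have r': "fst (snd r) \<noteq> y" using r assms(2) by (auto simp: grid_def column_def)
  show thesis
  proof (cases "fst (snd q) = y \<and> fst r = x")
    case True
    then show thesis using that[OF q(1) r(1)] q' r' by auto
  next
    case False
    then show thesis using that[OF p q(1)] that[OF p r(1)] q' r' by auto
  qed
qed

lemma color_class_cases:
  assumes "proper_coloring (grid_hypergraph l m a b) c" "2 \<le> m" "1 \<le> a"
  obtains (small) "card (color_class m a b c k) < m"
    | (row) x where "x \<in> {1..a}" "color_class m a b c k \<subseteq> row m b x"
    | (column) y where "y \<in> {1..b}" "color_class m a b c k \<subseteq> column m a y"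
proof -
  define K where "K = color_class m a b c k"
  have KV: "K \<subseteq> grid m a b" by (auto simp: K_def)
  have "card K < m \<or> (\<exists>x\<in>{1..a}. K \<subseteq> row m b x) \<or> (\<exists>y\<in>{1..b}. K \<subseteq> column m a y)"
  proof (rule ccontr)
    assume neg: "\<not> ?thesis"
    have K: "m \<le> card K"
      "\<not> (\<exists>x\<in>{1..a}. K \<subseteq> row m b x)" "\<not> (\<exists>y\<in>{1..b}. K \<subseteq> column m a y)"
      using neg unfolding not_less[symmetric] by blast+
    obtain u v where uv: "u \<in> K" "v \<in> K" "fst u \<noteq> fst v" "fst (snd u) \<noteq> fst (snd v)"
      using not_in_line_imp_differ_in_both[OF assms(3) KV K(2,3)] .
    \<comment> \<open>As \<open>2 \<le> m \<le> card K\<close>, the pair extends to an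
      \<open>m\<close>-subset \<open>T\<close> of \<open>K\<close>; \<open>u\<close> and
      \<open>v\<close> keep \<open>T\<close> out of every row and column, so \<open>T\<close> is a
      monochromatic \<open>D\<close>-edge.\<close>
    have "card {u, v} \<le> m" using assms(2) by (simp add: card_insert_if)
    with uv K(1) obtain T where T: "{u, v} \<subseteq> T" "T \<subseteq> K" "card T = m"
      using exists_subset_between[of "{u, v}" m K] finite_subset[OF KV finite_grid] by auto
    have "\<not> {u, v} \<subseteq> row m b x" "\<not> {u, v} \<subseteq> column m a x" for x
      using uv(3,4) by (auto simp: row_def column_def)
    then have "\<not> T \<subseteq> row m b x" "\<not> T \<subseteq> column m a x" for x
      using T(1) by (meson subset_trans)+
    with T KV have "T \<in> D_edges (grid_hypergraph l m a b)"
      by (simp add: grid_hypergraph_def)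
    with assms(1) T(2) show False
      unfolding proper_coloring_def K_def by blast
  qed
  then show thesis using small row column unfolding K_def by blast
qed

text \<open>Since \<open>a < b\<close>, a column has fewer vertices than a row, and so does any set
  with fewer than \<open>m\<close> vertices; only classes inside a row can reach
  \<open>b * m\<close>.\<close>

lemma card_color_class_le:
  assumes "proper_coloring (grid_hypergraph l m a b) c" "2 \<le> m" "1 \<le> a" "a < b"
  shows "card (color_class m a b c k) \<le> b * m"
    and "card (color_class m a b c k) = b * m \<Longrightarrow>
           \<exists>x\<in>{1..a}. color_class m a b c k = row m b x"
proof -
  let ?K = "color_class m a b c k"
  have "card ?K < b * m \<or> (\<exists>x\<in>{1..a}. ?K \<subseteq> row m b x)"
    using assms(1-3)
  proof (cases rule: color_class_cases[where k = k])
    case small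
    moreover have "1 * m \<le> b * m" using assms(4) by (intro mult_le_mono1) simp
    ultimately show ?thesis by linarith
  next
    case (column y)
    then have "card ?K \<le> a * m"
      using card_mono[of "column m a y" ?K] by (simp add: card_column column_def)
    moreover have "a * m < b * m" using assms(2,4) by simp
    ultimately show ?thesis by linarith
  qed blast
  moreover have "card ?K \<le> b * m" "card ?K = b * m \<Longrightarrow> ?K = row m b x" if "?K \<subseteq> row m b x" for x
    using that card_mono[of "row m b x" ?K] card_subset_eq[of "row m b x" ?K] card_row[of m b x]
    by (auto simp: row_def)
  ultimately show "card ?K \<le> b * m" "card ?K = b * m \<Longrightarrow> \<exists>x\<in>{1..a}. ?K = row m b x"
    by fastforce+
qed

section \<open>Counting vertices by color class: the minimum number of colors and its equality
  case\<close>

lemma card_grid_eq_sum_color_classes: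
  "a * (b * m) = (\<Sum>k\<in>c ` grid m a b. card (color_class m a b c k))"
  using sum.image_gen[OF finite_grid[of m a b], of "\<lambda>_. 1 :: nat" c]
  by (simp add: card_grid)

lemma num_colors_ge:
  assumes "proper_s_coloring (grid_hypergraph l m a b) s c" "2 \<le> m" "1 \<le> a" "a < b"
  shows "a \<le> s"
proof -
  have c: "proper_coloring (grid_hypergraph l m a b) c" "card (c ` grid m a b) = s"
    using assms(1) by (auto simp: proper_s_coloring_def grid_hypergraph_def)
  have "a * (b * m) \<le> (\<Sum>k\<in>c ` grid m a b. b * m)"
    unfolding card_grid_eq_sum_color_classes[of a b m c]
    by (intro sum_mono card_color_class_le[OF c(1) assms(2-4)])
  also have "\<dots> = s * (b * m)" by (simp add: c(2))
  finally show ?thesis using assms(2,4) by simp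
qed

lemma proper_a_coloring_imp_row_coloring:
  assumes "proper_s_coloring (grid_hypergraph l m a b) a c" "2 \<le> m" "1 \<le> a" "a < b"
  shows "row_coloring m a b c"
proof -
  have c: "proper_coloring (grid_hypergraph l m a b) c" "card (c ` grid m a b) = a"
    using assms(1) by (auto simp: proper_s_coloring_def grid_hypergraph_def)
  note bound = card_color_class_le[OF c(1) assms(2-4)]
  \<comment> \<open>The \<open>a\<close> class sizes, each at most \<open>b * m\<close>, add up to
    \<open>a * (b * m)\<close>, so a single smaller class would make the sum too small.\<close>
  have full: "card (color_class m a b c k) = b * m" if k: "k \<in> c ` grid m a b" for k
  proof (rule ccontr)
    assume "card (color_class m a b c k) \<noteq> b * m"
    with bound(1)[of k] have "card (color_class m a b c k) < b * m" by simp
    with k have "a * (b * m) < (\<Sum>k\<in>c ` grid m a b. b * m)"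
      unfolding card_grid_eq_sum_color_classes[of a b m c]
      by (intro sum_strict_mono_ex1 ballI bound(1) bexI[of _ k]) (simp_all add: finite_grid)
    then show False by (simp add: c(2))
  qed
  have class_eq_row: "color_class m a b c (c u) = row m b x"
    if "x \<in> {1..a}" "u \<in> row m b x" for u x
  proof -
    have u: "u \<in> grid m a b" using that by (auto simp: row_def grid_def)
    then obtain x' where x': "color_class m a b c (c u) = row m b x'"
      using bound(2)[OF full[of "c u"]] by blast
    \<comment> \<open>Rows are disjoint, so the full row that forms the class of \<open>u\<close> is
      the row of \<open>u\<close>.\<close>
    then have "u \<in> row m b x'" using u by blast
    then have "x' = x" using that(2) by (auto simp: row_def)
    then show ?thesis using x' by simp
  qed
  show ?thesis
    unfolding row_coloring_def monochromatic_def
  proof (intro conjI ballI impI)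
    fix x u v assume "x \<in> {1..a}" "u \<in> row m b x" "v \<in> row m b x"
    then have "v \<in> color_class m a b c (c u)" by (simp only: class_eq_row)
    then show "c u = c v" by simp
  next
    fix x x' u v
    assume h: "x \<in> {1..a}" "x' \<in> {1..a}" "x \<noteq> x'" "u \<in> row m b x" "v \<in> row m b x'"
    then have "row m b x \<noteq> row m b x'" by (auto simp: row_def)
    then show "c u \<noteq> c v" using class_eq_row[of x u] class_eq_row[of x' v] h by metis
  qed
qed

section \<open>Colorings with at least \<open>l\<close> colors\<close>

lemma many_colors_imp_column_coloring:
  assumes "proper_s_coloring (grid_hypergraph l m a b) s c" "2 \<le> l" "2 \<le> m" "1 < a" "l \<le> s"
  shows "column_coloring m a b c"
proof -
  let ?V = "grid m a b"
  have c: "proper_coloring (grid_hypergraph l m a b) c" "card (c ` ?V) = s"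
    using assms(1) by (auto simp: proper_s_coloring_def grid_hypergraph_def)
  have colV: "column m a y \<subseteq> ?V" if "y \<in> {1..b}" for y
    using that by (auto simp: column_def grid_def)
  have mono: "c u = c v" if y: "y \<in> {1..b}" and uv: "u \<in> column m a y" "v \<in> column m a y" for y u v
  proof (rule ccontr)
    assume ne: "c u \<noteq> c v"
    have V: "u \<in> ?V" "v \<in> ?V" using colV y uv by blast+
    obtain L where L: "{c u, c v} \<subseteq> L" "L \<subseteq> c ` ?V" "card L = l"
      using exists_subset_between[of "{c u, c v}" l "c ` ?V"] V ne c(2) assms(2,5)
      by (auto simp: finite_grid)
    \<comment> \<open>A choice of one vertex per color, forced through \<open>u\<close> and
      \<open>v\<close> so that the image of \<open>L\<close> has two vertices in column
      \<open>y\<close>. That image is a \<open>C\<close>-edge on which \<open>c\<close> is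
      injective.\<close>
    define g where "g k = (if k = c u then u else if k = c v then v else inv_into ?V c k)" for k
    have cg: "c (g k) = k" and gV: "g k \<in> ?V" if "k \<in> L" for k
      using that L(2) V by (auto simp: g_def f_inv_into_f inv_into_into subsetD)
    have "inj_on g L" by (metis cg inj_on_inverseI)
    then have "card (g ` L) = l" using L(3) by (simp add: card_image)
    moreover have "u \<in> g ` L" "v \<in> g ` L"
      using L(1) ne imageI[of "c u" L g] imageI[of "c v" L g] by (auto simp: g_def)
    moreover have "g ` L \<subseteq> ?V" "u \<noteq> v" using gV ne by auto
    moreover note y uv
    ultimately have "g ` L \<in> C_edges (grid_hypergraph l m a b)"
      unfolding grid_hypergraph_def mixed_hypergraph.simps by blast
    then obtain p q where "p \<in> g ` L" "q \<in> g ` L" "p \<noteq> q" "c p = c q"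
      using c(1) unfolding proper_coloring_def by blast
    then show False using cg by auto
  qed
  moreover have "c u \<noteq> c v"
    if y: "y \<in> {1..b}" "y' \<in> {1..b}" "y \<noteq> y'" and u: "u \<in> column m a y" "v \<in> column m a y'"
    for y y' u v
  proof
    assume eq: "c u = c v"
    let ?K = "color_class m a b c (c u)"
    have K: "column m a y \<subseteq> ?K" "column m a y' \<subseteq> ?K"
      using mono[OF y(1) _ u(1)] mono[OF y(2) _ u(2)] colV[OF y(1)] colV[OF y(2)] eq by auto
    \<comment> \<open>The first two points lie in different rows (here \<open>1 < a\<close> is
      needed), the first and third in different columns, so the class fits in no row and no
      column.\<close>
    have pts: "(1, y, 1) \<in> ?K" "(2, y, 1) \<in> ?K" "(1, y', 1) \<in> ?K"
      using K[THEN subsetD] assms(3,4) unfolding column_def by simp_all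
    from c(1) assms(3) less_imp_le[OF assms(4)] show False
    proof (cases rule: color_class_cases[where k = "c u"])
      case small
      have "a * m \<le> card ?K"
        using card_mono[OF _ K(1)] by (simp add: card_column finite_grid)
      moreover have "1 * m \<le> a * m" using assms(4) by (intro mult_le_mono1) simp
      ultimately show False using small by linarith
    next
      case (row x)
      then have "(1, y, 1) \<in> row m b x" "(2, y, 1) \<in> row m b x" using pts by blast+
      then show False by (simp add: row_def)
    next
      case (column w)
      then have "(1, y, 1) \<in> column m a w" "(1, y', 1) \<in> column m a w" using pts by blast+
      then show False using y(3) by (simp add: column_def)
    qed
  qed
  ultimately show ?thesis unfolding column_coloring_def monochromatic_def by blast
qed

text \<open>The points \<open>(1, y, 1)\<close> represent the columns, so colors correspond
  bijectively to columns. This serves both to force \<open>s = b\<close> when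
  \<open>l \<le> s\<close> and to count the colors of the explicit column-coloring.\<close>

lemma num_colors_column_coloring:
  assumes "column_coloring m a b c" "1 \<le> a" "1 \<le> m"
  shows "card (c ` grid m a b) = b"
proof -
  let ?r = "\<lambda>y. (1, y, 1) :: vertex"
  have r: "?r y \<in> column m a y" for y using assms by (simp add: column_def)
  have "c ` grid m a b = (\<lambda>y. c (?r y)) ` {1..b}"
  proof (intro subset_antisym subsetI)
    fix k assume "k \<in> c ` grid m a b"
    then obtain x y z where k: "k = c (x, y, z)" and V: "(x, y, z) \<in> grid m a b" by auto
    then have y: "y \<in> {1..b}" and "(x, y, z) \<in> column m a y"
      by (auto simp: grid_def column_def)
    then have "k = c (?r y)"
      using assms(1) r[of y] unfolding k column_coloring_def monochromatic_def by blast
    then show "k \<in> (\<lambda>y. c (?r y)) ` {1..b}" using y by blast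
  next
    fix k assume "k \<in> (\<lambda>y. c (?r y)) ` {1..b}"
    then show "k \<in> c ` grid m a b" using assms by (auto simp: grid_def)
  qed
  moreover have "inj_on (\<lambda>y. c (?r y)) {1..b}"
    using assms(1) r unfolding column_coloring_def inj_on_def by blast
  ultimately show ?thesis by (simp add: card_image)
qed

section \<open>Constructions of proper colorings\<close>

lemma exists_proper_coloring_few_colors:
  assumes "1 \<le> a" "1 \<le> m" "a \<le> s" "s < l" "s \<le> b"
  shows "\<exists>c. proper_s_coloring (grid_hypergraph l m a b) s c"
proof -
  \<comment> \<open>Rows \<open>1..a-1\<close> are monochromatic; row \<open>a\<close> is split by columns into \<open>s - a + 1\<close> classes.\<close>
  define c where "c v = (if fst v < a then fst v else a + min (fst (snd v) - 1) (s - a))"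
    for v :: vertex
  \<comment> \<open>Colors below \<open>a\<close> each belong to one row and the others occur only
    in row \<open>a\<close>. Hence a monochromatic set lies in one row and cannot be a
    \<open>D\<close>-edge.\<close>
  have fst_eq: "fst u = fst v" if "u \<in> grid m a b" "v \<in> grid m a b" "c u = c v" for u v
    using that by (auto simp: c_def grid_def split: if_splits)
  have image: "c ` grid m a b = {1..s}"
  proof (intro subset_antisym subsetI)
    fix k assume "k \<in> c ` grid m a b"
    then show "k \<in> {1..s}" using assms by (auto simp: c_def grid_def)
  next
    fix k assume k: "k \<in> {1..s}"
    show "k \<in> c ` grid m a b"
    proof (cases "k < a")
      case True
      then have "(k, 1, 1) \<in> grid m a b" "k = c (k, 1, 1)"
        using k assms by (simp_all add: grid_def c_def)
      then show ?thesis by blast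
    next
      case False
      \<comment> \<open>Columns are numbered from 1, hence the shift; \<open>s \<le> b\<close>
        ensures that this column exists.\<close>
      then have "(a, k - a + 1, 1) \<in> grid m a b" "k = c (a, k - a + 1, 1)"
        using k assms by (simp_all add: grid_def c_def)
      then show ?thesis by blast
    qed
  qed
  have "\<exists>u\<in>e. \<exists>v\<in>e. u \<noteq> v \<and> c u = c v" if "e \<in> C_edges (grid_hypergraph l m a b)" for e
  proof -
    have e: "e \<subseteq> grid m a b" "card e = l" using that by (auto simp: grid_hypergraph_def)
    \<comment> \<open>Pigeonhole: a \<open>C\<close>-edge has \<open>l\<close> vertices, but only
      \<open>s < l\<close> colors are available.\<close>
    then have "card (c ` e) \<le> s"
      using card_mono[of "{1..s}" "c ` e"] image by auto
    then have "\<not> inj_on c e" using e(2) assms(4) by (auto dest: card_image)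
    then show ?thesis unfolding inj_on_def by blast
  qed
  moreover have "\<exists>u\<in>e. \<exists>v\<in>e. c u \<noteq> c v" if "e \<in> D_edges (grid_hypergraph l m a b)" for e
  proof (rule ccontr)
    assume same: "\<not> ?thesis"
    have e: "e \<subseteq> grid m a b" "card e = m" "\<not> (\<exists>x\<in>{1..a}. e \<subseteq> row m b x)"
      using that by (auto simp: grid_hypergraph_def)
    have "e \<noteq> {}" using e(2) assms(2) by auto
    then obtain p where p: "p \<in> e" by blast
    have "e \<subseteq> row m b (fst p)"
    proof
      fix v assume v: "v \<in> e"
      then have "fst v = fst p" using fst_eq same p e(1) by blast
      then show "v \<in> row m b (fst p)" using v e(1) by (auto simp: row_def grid_def)
    qed
    moreover have "fst p \<in> {1..a}" using p e(1) by (auto simp: grid_def)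
    ultimately show False using e(3) by blast
  qed
  ultimately have "proper_s_coloring (grid_hypergraph l m a b) s c"
    using image by (simp add: proper_s_coloring_def proper_coloring_def grid_hypergraph_def)
  then show ?thesis by blast
qed

text \<open>Color each vertex by its column index: a \<open>C\<close>-edge contains two vertices of
  one column, and a \<open>D\<close>-edge is not confined to one column.\<close>

lemma exists_proper_b_coloring:
  assumes "1 \<le> a" "1 \<le> m"
  shows "\<exists>c. proper_s_coloring (grid_hypergraph l m a b) b c"
proof -
  define c where "c v = fst (snd v)" for v :: vertex
  have "\<exists>u\<in>e. \<exists>v\<in>e. u \<noteq> v \<and> c u = c v" if e: "e \<in> C_edges (grid_hypergraph l m a b)" for e
  proof -
    obtain y u v where "u \<in> e" "v \<in> e" "u \<noteq> v" "u \<in> column m a y" "v \<in> column m a y"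
      using e unfolding grid_hypergraph_def mixed_hypergraph.simps by blast
    moreover from this have "c u = c v" by (auto simp: c_def column_def)
    ultimately show ?thesis by blast
  qed
  moreover have "\<exists>u\<in>e. \<exists>v\<in>e. c u \<noteq> c v" if "e \<in> D_edges (grid_hypergraph l m a b)" for e
  proof (rule ccontr)
    assume same: "\<not> ?thesis"
    have e: "e \<subseteq> grid m a b" "card e = m" "\<not> (\<exists>y\<in>{1..b}. e \<subseteq> column m a y)"
      using that by (auto simp: grid_hypergraph_def)
    have "e \<noteq> {}" using e(2) assms(2) by auto
    then obtain p where p: "p \<in> e" by blast
    have "e \<subseteq> column m a (c p)"
    proof
      fix v assume v: "v \<in> e"
      then have "c v = c p" using same p by blast
      then show "v \<in> column m a (c p)" using v e(1) by (auto simp: column_def grid_def c_def)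
    qed
    moreover have "c p \<in> {1..b}" using p e(1) by (auto simp: grid_def c_def)
    ultimately show False using e(3) by blast
  qed
  moreover have "column_coloring m a b c"
    by (auto simp: column_coloring_def monochromatic_def column_def c_def)
  ultimately have "proper_s_coloring (grid_hypergraph l m a b) b c"
    using num_colors_column_coloring[OF _ assms, of b c]
    by (simp add: proper_s_coloring_def proper_coloring_def grid_hypergraph_def)
  then show ?thesis by blast
qed

theorem theorem4:
  fixes l m a b :: nat
  assumes "l \<ge> 2" and "m \<ge> 2" and "1 < a" and "a < l" and "l \<le> b"
  shows "S (grid_hypergraph l m a b) = {a..l - 1} \<union> {b}
       \<and> (\<forall>c. proper_s_coloring (grid_hypergraph l m a b) a c \<longrightarrow> row_coloring m a b c)
       \<and> (\<forall>c. proper_s_coloring (grid_hypergraph l m a b) b c \<longrightarrow> column_coloring m a b c)"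
proof (intro conjI allI impI)
  have le: "1 \<le> a" "1 \<le> m" "a < b" using assms by auto
  show "S (grid_hypergraph l m a b) = {a..l - 1} \<union> {b}"
  proof (intro subset_antisym subsetI)
    fix s assume "s \<in> S (grid_hypergraph l m a b)"
    then obtain c where c: "proper_s_coloring (grid_hypergraph l m a b) s c"
      by (auto simp: S_def)
    have "a \<le> s" using num_colors_ge[OF c assms(2) le(1,3)] .
    moreover have "s = b" if "l \<le> s"
    proof -
      have "card (c ` grid m a b) = b"
        using many_colors_imp_column_coloring[OF c assms(1-3) that] le(1,2)
        by (rule num_colors_column_coloring)
      then show ?thesis using c by (simp add: proper_s_coloring_def grid_hypergraph_def)
    qed
    ultimately show "s \<in> {a..l - 1} \<union> {b}" by force
  next
    fix s assume "s \<in> {a..l - 1} \<union> {b}"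
    \<comment> \<open>In the first case \<open>l \<le> b\<close> supplies the bound
      \<open>s \<le> b\<close> needed to split row \<open>a\<close> into enough classes.\<close>
    then consider "a \<le> s" "s < l" | "s = b" using assms by force
    then show "s \<in> S (grid_hypergraph l m a b)"
      using exists_proper_coloring_few_colors[OF le(1,2), of s l b]
        exists_proper_b_coloring[OF le(1,2), of l b] assms(5)
      by cases (auto simp: S_def)
  qed
  fix c
  show "row_coloring m a b c" if "proper_s_coloring (grid_hypergraph l m a b) a c"
    using proper_a_coloring_imp_row_coloring[OF that assms(2) le(1,3)] .
  show "column_coloring m a b c" if "proper_s_coloring (grid_hypergraph l m a b) b c"
    using many_colors_imp_column_coloring[OF that assms(1-3,5)] .
qed

end
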